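(* Let $v\ge 32$ be an integer with $v\equiv 4,8,28,32,44$ or $52 \pmod{60}$, and let $m$ be a positive integer with $m\le (v-1)/30$. Then there exists a simple $3-\bigl(2v,7,\tfrac{35}{4}v(v-2)(v-3)m\bigr)$ design.
   Context: A $t-(v,k,\lambda)$ design is a pair $(X,\mathcal B)$ with $|X|=v$ and $\mathcal B$ a collection of $k$-subsets (blocks) of $X$ such that every $t$-subset of $X$ is contained in exactly $\lambda$ blocks. It is simple if it has no repeated blocks. *)

theory Defs
  imports Complex_Main "HOL-Library.Multiset"
begin

text \<open>A \<open>t\<close>-\<open>(v,k,\<lambda>)\<close> design. The blocks form a multiset, so that repeated blocks are
  allowed in general and simplicity is a genuine condition.\<close>

definition t_design ::
  "nat \<Rightarrow> nat \<Rightarrow> nat \<Rightarrow> nat \<Rightarrow> 'a set \<Rightarrow> 'a set multiset \<Rightarrow> bool" where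
  "t_design t v k lam X B \<longleftrightarrow>
     finite X \<and> card X = v \<and>
     (\<forall>b \<in># B. b \<subseteq> X \<and> card b = k) \<and>
     (\<forall>T. T \<subseteq> X \<and> card T = t \<longrightarrow> size {# b \<in># B. T \<subseteq> b #} = lam)"

definition simple_blocks :: "'a set multiset \<Rightarrow> bool" where
  "simple_blocks B \<longleftrightarrow> (\<forall>b \<in># B. count B b = 1)"

end

theory Submission
  imports Defs
begin

text \<open>The \<open>2v\<close> points are two copies of \<open>{..<v}\<close>, and a block is the union of a subset \<open>A\<close> of the
  first copy and a subset \<open>B\<close> of the second one, where \<open>(card A, card B)\<close> is one of (5,2), (2,5),
  (4,3), (3,4). Which pairs are used is decided by colours. For every \<open>k\<close> from 2 to 5 the \<open>k\<close>-subsets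
  of \<open>{..<v}\<close> are coloured such that each colour class covers all points equally often
  (\<open>regular_colouring\<close>); the types (5,2) and (2,5) use \<open>v - 1\<close> colours, the types (4,3) and (3,4)
  use \<open>N = (v - 1) (v - 2) / 6\<close>. A pair is kept when the sum of the two colours lies in a window of
  length \<open>z\<close> modulo the number of colours. Since the colour classes are 1-designs, the number of kept
  pairs above a given triple depends only on how the triple splits between the two copies
  (\<open>card_pairs_above_empty\<close>, \<open>card_pairs_above_point\<close>). There are two kinds of splits, 3 + 0 and 2 + 1,
  hence two linear equations for the two window lengths. Their solution for the required index is
  \<open>30 m\<close> for the types (5,2), (2,5) and \<open>m (v + 10)\<close> for the types (4,3), (3,4). The bound
  \<open>m \<le> (v - 1) / 30\<close> says that the first window fits among \<open>v - 1\<close> colours; the second one then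
  fits among \<open>N\<close>. Distinct pairs give distinct blocks, so the design is simple.

  The colourings come from the cyclic group of order \<open>v\<close>, whose orbits on \<open>k\<close>-subsets are regular.
  The hypothesis on \<open>v mod 60\<close> says that \<open>v\<close> is divisible by 4 and prime to 3, and that 5 divides
  neither \<open>v\<close> nor \<open>v - 1\<close>. Therefore the orbits on 3-subsets and on 5-subsets all have length \<open>v\<close>, and
  it remains to distribute them equally: one orbit per colour for \<open>k = 3\<close>, and
  \<open>(v - 2) (v - 3) (v - 4) / 120\<close> orbits per colour for \<open>k = 5\<close>. For \<open>k = 2\<close> the colouring is a
  one-factorisation of the complete graph. For \<open>k = 4\<close> some orbits are short, and degrees up to 4 have
  to be packed into \<open>N\<close> classes of degree exactly \<open>v - 3\<close>. A greedy packing succeeds as soon as there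
  are at least \<open>3 N\<close> pieces of degree 1 (\<open>greedy_packing\<close>). Those are supplied by the 4-subsets that meet
  each residue class modulo 4: their orbits under the subgroup of index 4 are partitions of the points,
  and there are at least \<open>(v / 4)\<^sup>3\<close> of them (\<open>many_light_pieces\<close>), which is enough for \<open>v \<ge> 32\<close>.\<close>

section \<open>Regular colourings\<close>

definition ksubsets :: "nat \<Rightarrow> nat \<Rightarrow> nat set set" where
  "ksubsets v k = {A. A \<subseteq> {..<v} \<and> card A = k}"

text \<open>A regular colouring resolves the complete design of all \<open>k\<close>-subsets into \<open>N\<close>
  classes, each of which is a 1-design in which every point has the same degree \<open>d\<close>.\<close>

definition regular_colouring :: "(nat set \<Rightarrow> nat) \<Rightarrow> nat \<Rightarrow> nat \<Rightarrow> nat \<Rightarrow> nat \<Rightarrow> bool" where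
  "regular_colouring c v k N d \<longleftrightarrow>
     (\<forall>A \<in> ksubsets v k. c A < N) \<and>
     (\<forall>i < N. \<forall>x < v. card {A \<in> ksubsets v k. c A = i \<and> x \<in> A} = d)"

text \<open>The case distinction guards against truncated subtraction: for \<open>t > k\<close> the binomial
  coefficient with lower index \<open>k - t\<close> would be 1.\<close>

definition supersets_count :: "nat \<Rightarrow> nat \<Rightarrow> nat \<Rightarrow> nat" where
  "supersets_count v k t = (if t \<le> k then (v - t) choose (k - t) else 0)"

lemma finite_ksubsets [simp]: "finite (ksubsets v k)"
  unfolding ksubsets_def by (rule finite_subset[of _ "Pow {..<v}"]) auto

lemma finite_ksubset: "A \<in> ksubsets v k \<Longrightarrow> finite A"
  unfolding ksubsets_def using finite_subset by blast

lemma card_supersets: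
  assumes "T \<subseteq> {..<v}" "card T = t"
  shows "card {A \<in> ksubsets v k. T \<subseteq> A} = supersets_count v k t"
proof (cases "t \<le> k")
  case True
  have finT: "finite T" using assms(1) finite_subset by blast
  have "bij_betw (\<lambda>A. A - T) {A \<in> ksubsets v k. T \<subseteq> A} {B. B \<subseteq> {..<v} - T \<and> card B = k - t}"
  proof (rule bij_betw_byWitness[where f' = "\<lambda>B. B \<union> T"])
    show "(\<lambda>A. A - T) ` {A \<in> ksubsets v k. T \<subseteq> A} \<subseteq> {B. B \<subseteq> {..<v} - T \<and> card B = k - t}"
      using finT assms by (auto simp: ksubsets_def card_Diff_subset)
    show "(\<lambda>B. B \<union> T) ` {B. B \<subseteq> {..<v} - T \<and> card B = k - t} \<subseteq> {A \<in> ksubsets v k. T \<subseteq> A}"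
    proof (intro image_subsetI)
      fix B assume "B \<in> {B. B \<subseteq> {..<v} - T \<and> card B = k - t}"
      then have B: "B \<subseteq> {..<v} - T" "card B = k - t" by auto
      have "finite B" using B(1) finite_subset by blast
      then have "card (B \<union> T) = k"
        using B finT assms True by (subst card_Un_disjoint) auto
      then show "B \<union> T \<in> {A \<in> ksubsets v k. T \<subseteq> A}"
        using B assms by (auto simp: ksubsets_def)
    qed
  qed auto
  then have "card {A \<in> ksubsets v k. T \<subseteq> A} = card {B. B \<subseteq> {..<v} - T \<and> card B = k - t}"
    by (rule bij_betw_same_card)
  also have "\<dots> = card ({..<v} - T) choose (k - t)"
    by (rule n_subsets) simp
  also have "card ({..<v} - T) = v - t"
    using assms finT by (simp add: card_Diff_subset)
  finally show ?thesis using True by (simp add: supersets_count_def)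
next
  case False
  have "{A \<in> ksubsets v k. T \<subseteq> A} = {}"
  proof -
    have False if "A \<in> ksubsets v k" "T \<subseteq> A" for A
      using that card_mono[OF finite_ksubset[OF that(1)] that(2)] False assms
      by (simp add: ksubsets_def)
    then show ?thesis by blast
  qed
  then show ?thesis using False by (simp only: supersets_count_def) simp
qed

lemma sum_degrees:
  fixes F :: "nat set set"
  assumes "finite F" "\<And>A. A \<in> F \<Longrightarrow> A \<subseteq> {..<v}"
  shows "(\<Sum>x<v. card {A \<in> F. x \<in> A}) = (\<Sum>A\<in>F. card A)"
proof -
  have "(\<Sum>x<v. card {A \<in> F. x \<in> A}) = (\<Sum>x<v. \<Sum>A\<in>F. if x \<in> A then 1 else 0)"
    using assms(1) by (simp add: sum.If_cases Int_def)
  also have "\<dots> = (\<Sum>A\<in>F. \<Sum>x<v. if x \<in> A then 1 else 0)"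
    by (rule sum.swap)
  also have "\<dots> = (\<Sum>A\<in>F. card A)"
  proof (rule sum.cong[OF refl])
    fix A assume "A \<in> F"
    then have "{..<v} \<inter> A = A" using assms(2) by auto
    then show "(\<Sum>x<v. if x \<in> A then 1 else 0) = card A"
      by (simp add: sum.If_cases)
  qed
  finally show ?thesis .
qed

lemma sum_degrees_uniform:
  assumes "F \<subseteq> ksubsets v k"
  shows "(\<Sum>x<v. card {A \<in> F. x \<in> A}) = k * card F"
proof -
  have "finite F" using assms finite_ksubsets finite_subset by blast
  moreover have "(\<Sum>A\<in>F. card A) = (\<Sum>A\<in>F. k)"
    using assms by (intro sum.cong) (auto simp: ksubsets_def)
  ultimately show ?thesis
    using sum_degrees[of F v] assms by (simp add: ksubsets_def subset_iff mult.commute)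
qed

text \<open>Both sides count the incidences between the points and the members of one colour class.\<close>

lemma colour_class_size:
  assumes "regular_colouring c v k N d" "i < N"
  shows "k * card {A \<in> ksubsets v k. c A = i} = v * d"
proof -
  let ?F = "{A \<in> ksubsets v k. c A = i}"
  have "(\<Sum>x<v. card {A \<in> ?F. x \<in> A}) = (\<Sum>x<v. d)"
    using assms by (intro sum.cong) (auto simp: regular_colouring_def conj_assoc)
  then show ?thesis using sum_degrees_uniform[of ?F v k] by simp
qed

section \<open>Pairs of sets matched by colour\<close>

lemma inj_on_add_mod:
  fixes v s :: nat
  assumes "v > 0"
  shows "inj_on (\<lambda>x. (x + s) mod v) {..<v}"
proof (rule inj_on_inverseI[where g = "\<lambda>x. (x + (v * s - s)) mod v"])
  fix x assume "x \<in> {..<v}"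
  moreover have "x + s + (v * s - s) = x + v * s" using assms by simp
  ultimately show "((x + s) mod v + (v * s - s)) mod v = x"
    by (simp only: mod_add_left_eq) simp
qed

lemma card_shifted_colours:
  fixes N z i :: nat
  assumes "z \<le> N"
  shows "card {j. j < N \<and> (i + j) mod N < z} = z"
proof (cases "N = 0")
  case False
  then have N: "N > 0" by simp
  have inj: "inj_on (\<lambda>j. (i + j) mod N) {..<N}"
    using inj_on_add_mod[OF N, of i] by (simp add: add.commute)
  have "(\<lambda>j. (i + j) mod N) ` {..<N} = {..<N}"
    using N by (intro endo_inj_surj inj) auto
  moreover have "(\<lambda>j. (i + j) mod N) ` {j. j < N \<and> (i + j) mod N < z}
      = {l \<in> (\<lambda>j. (i + j) mod N) ` {..<N}. l < z}"
    by auto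
  ultimately have img: "(\<lambda>j. (i + j) mod N) ` {j. j < N \<and> (i + j) mod N < z} = {l \<in> {..<N}. l < z}"
    by simp
  have "inj_on (\<lambda>j. (i + j) mod N) {j. j < N \<and> (i + j) mod N < z}"
    by (rule inj_on_subset[OF inj]) auto
  then have "card {j. j < N \<and> (i + j) mod N < z}
      = card ((\<lambda>j. (i + j) mod N) ` {j. j < N \<and> (i + j) mod N < z})"
    by (rule card_image[symmetric])
  also note img
  also have "{l \<in> {..<N}. l < z} = {..<z}" using assms by auto
  finally show ?thesis by simp
qed (use assms in auto)

text \<open>Two sets are matched when the sum of their colours falls into a window of length \<open>z\<close>
  modulo \<open>N\<close>. For \<open>z \<le> N\<close>, every colour on one side then meets exactly \<open>z\<close> colours on the other side, and
  using the sum rather than the difference makes the relation symmetric, so that exchanging the two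
  sides needs no separate treatment.\<close>

definition band_pairs ::
  "nat \<Rightarrow> nat \<Rightarrow> (nat set \<Rightarrow> nat) \<Rightarrow> nat set set \<Rightarrow> (nat set \<Rightarrow> nat) \<Rightarrow> nat set set \<Rightarrow> (nat set \<times> nat set) set" where
  "band_pairs N z ca SA cb SB = {(A, B). A \<in> SA \<and> B \<in> SB \<and> (ca A + cb B) mod N < z}"

lemma card_band_pairs:
  assumes "finite SA" "finite SB" "z \<le> N"
    and "\<And>B. B \<in> SB \<Longrightarrow> cb B < N"
    and "\<And>j. j < N \<Longrightarrow> card {B \<in> SB. cb B = j} = e"
  shows "card (band_pairs N z ca SA cb SB) = card SA * (z * e)"
proof -
  have 1: "card {B \<in> SB. (i + cb B) mod N < z} = z * e" for i
  proof -
    let ?J = "{j. j < N \<and> (i + j) mod N < z}"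
    have "{B \<in> SB. (i + cb B) mod N < z} = (\<Union>j\<in>?J. {B \<in> SB. cb B = j})"
      using assms(4) by auto
    also have "card \<dots> = (\<Sum>j\<in>?J. card {B \<in> SB. cb B = j})"
      using assms(2) by (intro card_UN_disjoint) auto
    also have "\<dots> = (\<Sum>j\<in>?J. e)" using assms(5) by (intro sum.cong) auto
    also have "\<dots> = z * e" by (simp add: card_shifted_colours[OF assms(3)])
    finally show ?thesis .
  qed
  have "band_pairs N z ca SA cb SB = Sigma SA (\<lambda>A. {B \<in> SB. (ca A + cb B) mod N < z})"
    by (auto simp: band_pairs_def)
  then show ?thesis using assms(1,2) by (simp add: 1)
qed

lemma band_pairs_swap:
  "band_pairs N z ca SA cb SB = prod.swap ` band_pairs N z cb SB ca SA"
  by (auto simp: band_pairs_def add.commute image_iff)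

definition pairs_above ::
  "nat set \<Rightarrow> nat set \<Rightarrow> nat \<Rightarrow> nat \<Rightarrow> nat \<Rightarrow> (nat set \<Rightarrow> nat) \<Rightarrow> nat \<Rightarrow> (nat set \<Rightarrow> nat) \<Rightarrow> nat \<Rightarrow> (nat set \<times> nat set) set" where
  "pairs_above S T v N z ca a cb b =
     band_pairs N z ca {A \<in> ksubsets v a. S \<subseteq> A} cb {B \<in> ksubsets v b. T \<subseteq> B}"

lemma card_pairs_above_swap:
  "card (pairs_above S T v N z ca a cb b) = card (pairs_above T S v N z cb b ca a)"
  unfolding pairs_above_def
  by (subst band_pairs_swap) (rule card_image[OF inj_on_subset[OF inj_swap subset_UNIV]])

text \<open>Each \<open>A\<close> above \<open>S\<close> has \<open>z\<close> admissible colours for its partner, and all colour classes have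
  the same size \<open>e\<close>.\<close>

lemma card_pairs_above_empty:
  assumes "regular_colouring cb v b N db" "z \<le> N" "0 < b" "b * e = v * db"
    and "S \<subseteq> {..<v}" "card S = s"
  shows "card (pairs_above S {} v N z ca a cb b) = supersets_count v a s * (z * e)"
proof -
  have "card {B \<in> ksubsets v b. cb B = j} = e" if "j < N" for j
    using colour_class_size[OF assms(1) that] assms(3) by (simp flip: assms(4))
  moreover have "cb B < N" if "B \<in> ksubsets v b" for B
    using assms(1) that by (auto simp: regular_colouring_def)
  ultimately show ?thesis
    using card_supersets[OF assms(5,6), of a] assms(2)
    unfolding pairs_above_def by (subst card_band_pairs) auto
qed

text \<open>Regularity of the classes enters here: whichever \<open>A\<close> is chosen, each of its \<open>z\<close> admissible
  classes covers the point \<open>y\<close> exactly \<open>db\<close> times.\<close>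

lemma card_pairs_above_point:
  assumes "regular_colouring cb v b N db" "z \<le> N"
    and "S \<subseteq> {..<v}" "card S = s" "y < v"
  shows "card (pairs_above S {y} v N z ca a cb b) = supersets_count v a s * (z * db)"
proof -
  have "card {B \<in> {B \<in> ksubsets v b. {y} \<subseteq> B}. cb B = j} = db" if "j < N" for j
  proof -
    have eq: "{B \<in> {B \<in> ksubsets v b. {y} \<subseteq> B}. cb B = j} = {B \<in> ksubsets v b. cb B = j \<and> y \<in> B}"
      by auto
    show ?thesis unfolding eq using assms(1,5) that unfolding regular_colouring_def by blast
  qed
  moreover have "cb B < N" if "B \<in> {B \<in> ksubsets v b. {y} \<subseteq> B}" for B
    using assms(1) that by (simp add: regular_colouring_def)
  ultimately have "card (pairs_above S {y} v N z ca a cb b)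
      = card {A \<in> ksubsets v a. S \<subseteq> A} * (z * db)"
    unfolding pairs_above_def using assms(2) by (intro card_band_pairs) simp_all
  then show ?thesis by (simp only: card_supersets[OF assms(3,4)])
qed

section \<open>Equal distribution of weighted pieces\<close>

text \<open>Heavy items are placed first, each into any bin that still has room. If an item of weight
  at most \<open>W\<close> fits nowhere, every bin has at most \<open>W - 1\<close> units left; but the \<open>(W - 1) * N\<close>
  items of weight 1 that are still waiting need more room than that together with the item. Once
  only items of weight 1 remain, they fill the bins exactly.\<close>

lemma greedy_packing:
  fixes w :: "'i \<Rightarrow> nat" and cap :: "nat \<Rightarrow> nat"
  assumes "finite I" "N > 0"
    and "(\<Sum>i\<in>I. w i) = (\<Sum>j<N. cap j)"
    and "\<And>i. i \<in> I \<Longrightarrow> w i \<noteq> 1 \<Longrightarrow> w i \<le> W \<and> (W - 1) * N \<le> card {l \<in> I. w l = 1}"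
  shows "\<exists>f. (\<forall>i\<in>I. f i < N) \<and> (\<forall>j<N. (\<Sum>i | i \<in> I \<and> f i = j. w i) = cap j)"
  using assms(1,3,4)
proof (induction "card I" arbitrary: I cap)
  case 0
  then have I: "I = {}" by simp
  then have "\<forall>j<N. cap j = 0" using 0(3) by simp
  then show ?case by (simp add: I)
next
  case (Suc n)
  have fin: "finite I" by fact
  (* An item of weight 1 is chosen only when no other weight is left. *)
  obtain i where i: "i \<in> I" and pref: "w i = 1 \<longrightarrow> (\<forall>l\<in>I. w l = 1)"
  proof (cases "\<forall>l\<in>I. w l = 1")
    case True
    have "I \<noteq> {}" using Suc.hyps(2) by auto
    then show ?thesis using that True by blast
  next
    case False
    then show ?thesis using that by blast
  qed
  have tot: "(\<Sum>l\<in>I. w l) = w i + (\<Sum>l\<in>I-{i}. w l)"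
    using fin i by (rule sum.remove)
  have "\<exists>j<N. w i \<le> cap j"
  proof (rule ccontr)
    assume "\<not> ?thesis"
    then have lt: "cap j < w i" if "j < N" for j using that by (auto simp: not_le)
    have "(\<Sum>j<N. cap j) \<le> (\<Sum>j<N. w i - 1)"
      using lt by (intro sum_mono) fastforce
    then have ub: "(\<Sum>l\<in>I. w l) \<le> N * (w i - 1)" using Suc.prems(2) by simp
    have pos: "w i > 0" using lt[OF assms(2)] by simp
    show False
    proof (cases "w i = 1")
      case True
      then show False using ub tot by simp
    next
      case False
      then have W: "w i \<le> W" "(W - 1) * N \<le> card {l \<in> I. w l = 1}"
        using Suc.prems(3) i by auto
      have "card {l \<in> I. w l = 1} = (\<Sum>l | l \<in> I \<and> w l = 1. w l)" by simp
      also have "\<dots> \<le> (\<Sum>l\<in>I-{i}. w l)"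
        using fin False by (intro sum_mono2) auto
      finally have "N * (W - 1) + w i \<le> N * (w i - 1)" using W ub tot by (simp add: mult.commute)
      moreover have "N * (w i - 1) \<le> N * (W - 1)"
        using W(1) by (intro mult_le_mono2 diff_le_mono)
      ultimately show False using pos by linarith
    qed
  qed
  then obtain j where j: "j < N" "w i \<le> cap j" by blast
  let ?cap = "cap(j := cap j - w i)"
  have "(\<Sum>l<N. cap l) = cap j + (\<Sum>l\<in>{..<N}-{j}. cap l)"
    using j by (intro sum.remove) auto
  moreover have "(\<Sum>l<N. ?cap l) = ?cap j + (\<Sum>l\<in>{..<N}-{j}. ?cap l)"
    using j by (intro sum.remove) auto
  moreover have "(\<Sum>l\<in>{..<N}-{j}. ?cap l) = (\<Sum>l\<in>{..<N}-{j}. cap l)"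
    by (intro sum.cong) auto
  ultimately have sum': "(\<Sum>l\<in>I-{i}. w l) = (\<Sum>l<N. ?cap l)"
    using tot Suc.prems(2) j by simp
  have "\<exists>f. (\<forall>l\<in>I-{i}. f l < N) \<and> (\<forall>q<N. (\<Sum>l | l \<in> I-{i} \<and> f l = q. w l) = ?cap q)"
  proof (rule Suc.hyps(1)[OF _ _ sum'])
    show "n = card (I - {i})" using Suc.hyps(2) i fin by simp
    show "finite (I - {i})" using fin by simp
    fix l assume l: "l \<in> I - {i}" "w l \<noteq> 1"
    then have "w i \<noteq> 1" using pref by auto
    then have "{l \<in> I - {i}. w l = 1} = {l \<in> I. w l = 1}" by auto
    then show "w l \<le> W \<and> (W - 1) * N \<le> card {l \<in> I - {i}. w l = 1}"
      using Suc.prems(3)[of l] l by auto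
  qed
  then obtain f where f: "\<And>l. l \<in> I - {i} \<Longrightarrow> f l < N"
    "\<And>q. q < N \<Longrightarrow> (\<Sum>l | l \<in> I-{i} \<and> f l = q. w l) = ?cap q" by blast
  have "(\<Sum>l | l \<in> I \<and> (f(i := j)) l = q. w l) = cap q" if q: "q < N" for q
  proof (cases "q = j")
    case True
    have "{l. l \<in> I \<and> (f(i := j)) l = q} = insert i {l. l \<in> I - {i} \<and> f l = q}"
      using i True by auto
    moreover have "finite {l. l \<in> I - {i} \<and> f l = q}" using fin by simp
    ultimately show ?thesis using f(2)[OF q] True j by simp
  next
    case False
    have "{l. l \<in> I \<and> (f(i := j)) l = q} = {l. l \<in> I - {i} \<and> f l = q}"
      using False by auto
    then show ?thesis using f(2)[OF q] False by simp
  qed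
  then show ?case using f(1) j(1) by (intro exI[of _ "f(i := j)"]) auto
qed

text \<open>If the \<open>k\<close>-subsets fall into pieces that are themselves regular, of degree \<open>u\<close> times a
  weight, then a colouring that distributes the pieces evenly over \<open>N\<close> colours is regular. The
  total weight is read off from the degree of the point 0 in the family of all \<open>k\<close>-subsets.\<close>

lemma regular_colouring_from_pieces:
  fixes g :: "nat set \<Rightarrow> nat set set"
  assumes self: "\<And>A. A \<in> ksubsets v k \<Longrightarrow> A \<in> g A"
    and sub: "\<And>A. A \<in> ksubsets v k \<Longrightarrow> g A \<subseteq> ksubsets v k"
    and eq: "\<And>A B. A \<in> ksubsets v k \<Longrightarrow> B \<in> g A \<Longrightarrow> g B = g A"
    and deg: "\<And>A x. A \<in> ksubsets v k \<Longrightarrow> x < v \<Longrightarrow> card {B \<in> g A. x \<in> B} = u * w (g A)"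
    and heavy: "\<And>A. A \<in> ksubsets v k \<Longrightarrow> w (g A) \<noteq> 1 \<Longrightarrow>
      w (g A) \<le> W \<and> (W - 1) * N \<le> card {P \<in> g ` ksubsets v k. w P = 1}"
    and total: "u * (N * c) = supersets_count v k 1"
    and pos: "N > 0" "v > 0" "u > 0"
  shows "\<exists>col. regular_colouring col v k N (u * c)"
proof -
  let ?I = "g ` ksubsets v k"
  have finI: "finite ?I" by simp
  have finP: "finite P" if "P \<in> ?I" for P using that sub finite_subset[OF _ finite_ksubsets] by blast
  have gP: "g A = P" if "P \<in> ?I" "A \<in> P" for A P using that eq by auto
  have Psub: "P \<subseteq> ksubsets v k" if "P \<in> ?I" for P using that sub by auto
  have count: "card {A \<in> ksubsets v k. g A \<in> J \<and> x \<in> A} = u * (\<Sum>P\<in>J. w P)"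
    if J: "J \<subseteq> ?I" and x: "x < v" for J x
  proof -
    have "{A \<in> ksubsets v k. g A \<in> J \<and> x \<in> A} = (\<Union>P\<in>J. {A \<in> P. x \<in> A})"
    proof (intro equalityI subsetI)
      fix A assume "A \<in> {A \<in> ksubsets v k. g A \<in> J \<and> x \<in> A}"
      then show "A \<in> (\<Union>P\<in>J. {A \<in> P. x \<in> A})" using self by auto
    next
      fix A assume "A \<in> (\<Union>P\<in>J. {A \<in> P. x \<in> A})"
      then obtain P where P: "P \<in> J" "A \<in> P" "x \<in> A" by auto
      then have I: "P \<in> ?I" using J by blast
      have "g A = P" by (rule gP[OF I P(2)])
      moreover have "A \<in> ksubsets v k" using Psub[OF I] P(2) by blast
      ultimately show "A \<in> {A \<in> ksubsets v k. g A \<in> J \<and> x \<in> A}"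
        using P by simp
    qed
    also have "card \<dots> = (\<Sum>P\<in>J. card {A \<in> P. x \<in> A})"
    proof (rule card_UN_disjoint)
      show "finite J" using J finI by (rule finite_subset)
      show "\<forall>P\<in>J. finite {A \<in> P. x \<in> A}"
      proof
        fix P assume "P \<in> J"
        then have "finite P" using J finP by blast
        then show "finite {A \<in> P. x \<in> A}" by simp
      qed
      show "\<forall>P\<in>J. \<forall>Q\<in>J. P \<noteq> Q \<longrightarrow> {A \<in> P. x \<in> A} \<inter> {A \<in> Q. x \<in> A} = {}"
      proof (intro ballI impI)
        fix P Q assume PQ: "P \<in> J" "Q \<in> J" "P \<noteq> Q"
        have "P = Q" if "A \<in> P" "A \<in> Q" for A
          using gP[of P A] gP[of Q A] that PQ(1,2) J by (metis subsetD)
        then have "P \<inter> Q = {}" using PQ(3) by blast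
        then show "{A \<in> P. x \<in> A} \<inter> {A \<in> Q. x \<in> A} = {}" by blast
      qed
    qed
    also have "\<dots> = (\<Sum>P\<in>J. u * w P)"
    proof (rule sum.cong[OF refl])
      fix P assume "P \<in> J"
      then obtain A where "A \<in> ksubsets v k" "P = g A" using J by blast
      then show "card {A \<in> P. x \<in> A} = u * w P" using deg x by simp
    qed
    finally show ?thesis by (simp add: sum_distrib_left)
  qed
  have "{A \<in> ksubsets v k. g A \<in> ?I \<and> 0 \<in> A} = {A \<in> ksubsets v k. {0} \<subseteq> A}" by auto
  then have "u * (\<Sum>P\<in>?I. w P) = supersets_count v k 1"
    using count[of ?I 0] card_supersets[of "{0}" v 1 k] pos by simp
  then have "u * (\<Sum>P\<in>?I. w P) = u * (N * c)" by (simp only: total)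
  then have "(\<Sum>P\<in>?I. w P) = N * c" using pos(3) by simp
  then have "(\<Sum>P\<in>?I. w P) = (\<Sum>j<N. c)" by simp
  then have "\<exists>f. (\<forall>P\<in>?I. f P < N) \<and> (\<forall>j<N. (\<Sum>P | P \<in> ?I \<and> f P = j. w P) = c)"
  proof (rule greedy_packing[OF finI pos(1)])
    fix P assume "P \<in> ?I" "w P \<noteq> 1"
    then obtain A where A: "P = g A" "A \<in> ksubsets v k" "w (g A) \<noteq> 1" by blast
    show "w P \<le> W \<and> (W - 1) * N \<le> card {P \<in> ?I. w P = 1}"
      unfolding A(1) by (rule heavy[OF A(2,3)])
  qed
  then obtain f where f: "\<forall>P\<in>?I. f P < N" "\<forall>j<N. (\<Sum>P | P \<in> ?I \<and> f P = j. w P) = c"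
    by (elim exE conjE)
  have "regular_colouring (\<lambda>A. f (g A)) v k N (u * c)"
    unfolding regular_colouring_def
  proof (intro conjI ballI allI impI)
    fix A assume "A \<in> ksubsets v k"
    then show "f (g A) < N" using f(1) by blast
  next
    fix i x assume "i < N" "x < v"
    moreover have "{A \<in> ksubsets v k. f (g A) = i \<and> x \<in> A}
       = {A \<in> ksubsets v k. g A \<in> {P \<in> ?I. f P = i} \<and> x \<in> A}" by auto
    ultimately show "card {A \<in> ksubsets v k. f (g A) = i \<and> x \<in> A} = u * c"
      using count[of "{P \<in> ?I. f P = i}" x] f(2) by simp
  qed
  then show ?thesis by blast
qed

section \<open>Orbits of cyclic translations\<close>

definition translate :: "nat \<Rightarrow> nat \<Rightarrow> nat set \<Rightarrow> nat set" where
  "translate v s A = (\<lambda>x. (x + s) mod v) ` A"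

definition orbit :: "nat \<Rightarrow> nat \<Rightarrow> nat set \<Rightarrow> nat set set" where
  "orbit v r A = range (\<lambda>s. translate v (r * s) A)"

lemma translate_translate: "translate v t (translate v s A) = translate v (s + t) A"
  by (simp add: translate_def image_image mod_add_left_eq add.assoc)

lemma translate_mult:
  assumes "A \<subseteq> {..<v}"
  shows "translate v (v * q) A = A"
  unfolding translate_def using assms by (simp add: subset_iff cong: image_cong_simp)

lemma translate_ksubsets:
  assumes "A \<in> ksubsets v k" "v > 0"
  shows "translate v s A \<in> ksubsets v k"
proof -
  have "inj_on (\<lambda>x. (x + s) mod v) A"
    using assms inj_on_subset[OF inj_on_add_mod[OF assms(2)]] by (auto simp: ksubsets_def)
  then have "card (translate v s A) = card A" by (simp add: translate_def card_image)
  then show ?thesis using assms by (auto simp: ksubsets_def translate_def)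
qed

lemma orbit_self: "A \<subseteq> {..<v} \<Longrightarrow> A \<in> orbit v r A"
  unfolding orbit_def using translate_mult[of A v 0] by (intro range_eqI[of _ _ 0]) simp

text \<open>The step back from \<open>translate v (r * s) A\<close> to \<open>A\<close> is the translation by
  \<open>r * (v * s - s)\<close>, a natural number congruent to \<open>- r * s\<close> modulo \<open>v\<close>.\<close>

lemma orbit_eq:
  assumes "A \<subseteq> {..<v}" "v > 0" "B \<in> orbit v r A"
  shows "orbit v r B = orbit v r A"
proof -
  obtain s where B: "B = translate v (r * s) A" using assms(3) by (auto simp: orbit_def)
  have sub: "orbit v r (translate v (r * s) C) \<subseteq> orbit v r C" for s C
    by (auto simp: orbit_def translate_translate simp flip: distrib_left)
  have "translate v (r * (v * s - s)) B = A"
  proof -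
    have "r * s + r * (v * s - s) = v * (r * s)"
      using assms(2) by (simp add: diff_mult_distrib2 algebra_simps)
    then show ?thesis using assms(1) by (simp add: B translate_translate translate_mult)
  qed
  then have "orbit v r A \<subseteq> orbit v r B" using sub[of "v * s - s" B] by simp
  then show ?thesis using sub[of s A] B by auto
qed

lemma orbit_ksubsets:
  assumes "A \<in> ksubsets v k" "v > 0"
  shows "orbit v r A \<subseteq> ksubsets v k"
  using translate_ksubsets[OF assms] by (auto simp: orbit_def)

lemma card_orbit_le:
  assumes "r dvd v" "v > 0" "A \<subseteq> {..<v}"
  shows "card (orbit v r A) \<le> v div r"
proof -
  have r: "r * (v div r) = v" using assms(1) by simp
  have "orbit v r A \<subseteq> (\<lambda>s. translate v (r * s) A) ` {..<v div r}"
  proof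
    fix B assume "B \<in> orbit v r A"
    then obtain s where B: "B = translate v (r * s) A" by (auto simp: orbit_def)
    let ?q = "v div r"
    have q: "?q > 0" using r assms(2) by (cases "?q") auto
    have "r * s = r * (?q * (s div ?q) + s mod ?q)" by simp
    also have "\<dots> = (r * ?q) * (s div ?q) + r * (s mod ?q)"
      by (simp only: distrib_left mult.assoc)
    finally have "r * s = v * (s div ?q) + r * (s mod ?q)" by (simp only: r)
    then have "B = translate v (r * (s mod ?q)) A"
      using B translate_translate[of v "r * (s mod ?q)" "v * (s div ?q)" A]
        translate_mult[OF assms(3)] by simp
    then show "B \<in> (\<lambda>s. translate v (r * s) A) ` {..<?q}"
      by (rule image_eqI) (use q in simp)
  qed
  then have "card (orbit v r A) \<le> card ((\<lambda>s. translate v (r * s) A) ` {..<v div r})"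
    by (intro card_mono) auto
  also have "\<dots> \<le> v div r" using card_image_le[of "{..<v div r}"] by simp
  finally show ?thesis .
qed

text \<open>Translation by \<open>x\<close> carries the members of the orbit through 0 to those through \<open>x\<close>.\<close>

lemma orbit_degree_const:
  assumes "A \<in> ksubsets v k" "x < v"
  shows "card {B \<in> orbit v 1 A. x \<in> B} = card {B \<in> orbit v 1 A. 0 \<in> B}"
proof -
  have v: "v > 0" using assms by simp
  have sub: "B \<subseteq> {..<v}" if "B \<in> orbit v 1 A" for B
    using orbit_ksubsets[OF assms(1) v, of 1] that unfolding ksubsets_def by blast
  have closed: "translate v t B \<in> orbit v 1 A" if "B \<in> orbit v 1 A" for B t
    using that by (auto simp: orbit_def translate_translate)
  have "bij_betw (translate v x) {B \<in> orbit v 1 A. 0 \<in> B} {B \<in> orbit v 1 A. x \<in> B}"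
  proof (rule bij_betw_byWitness[where f' = "translate v (v - x)"])
    show "\<forall>B\<in>{B \<in> orbit v 1 A. 0 \<in> B}. translate v (v - x) (translate v x B) = B"
      using sub translate_mult[of _ v 1] assms(2) by (simp add: translate_translate)
    show "\<forall>B\<in>{B \<in> orbit v 1 A. x \<in> B}. translate v x (translate v (v - x) B) = B"
      using sub translate_mult[of _ v 1] assms(2) by (simp add: translate_translate)
    show "translate v x ` {B \<in> orbit v 1 A. 0 \<in> B} \<subseteq> {B \<in> orbit v 1 A. x \<in> B}"
    proof (rule image_subsetI)
      fix B assume B: "B \<in> {B \<in> orbit v 1 A. 0 \<in> B}"
      have "(0 + x) mod v \<in> translate v x B"
        unfolding translate_def using B by (intro imageI) simp
      then show "translate v x B \<in> {B \<in> orbit v 1 A. x \<in> B}" using B closed assms(2) by simp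
    qed
    show "translate v (v - x) ` {B \<in> orbit v 1 A. x \<in> B} \<subseteq> {B \<in> orbit v 1 A. 0 \<in> B}"
    proof (rule image_subsetI)
      fix B assume B: "B \<in> {B \<in> orbit v 1 A. x \<in> B}"
      have "(x + (v - x)) mod v \<in> translate v (v - x) B"
        unfolding translate_def using B by (intro imageI) simp
      then show "translate v (v - x) B \<in> {B \<in> orbit v 1 A. 0 \<in> B}"
        using B closed assms(2) by simp
    qed
  qed
  then show ?thesis by (rule bij_betw_same_card[symmetric])
qed

lemma orbit_size:
  assumes "A \<in> ksubsets v k" "v > 0"
  shows "v * card {B \<in> orbit v 1 A. 0 \<in> B} = k * card (orbit v 1 A)"
proof -
  have "(\<Sum>x<v. card {B \<in> orbit v 1 A. x \<in> B}) = (\<Sum>x<v. card {B \<in> orbit v 1 A. 0 \<in> B})"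
    by (intro sum.cong refl orbit_degree_const[OF assms(1)]) simp
  then show ?thesis using sum_degrees_uniform[OF orbit_ksubsets[OF assms, of 1]] by simp
qed

lemma orbit_degree_le:
  assumes "A \<in> ksubsets v k" "v > 0"
  shows "card {B \<in> orbit v 1 A. 0 \<in> B} \<le> k"
proof -
  have "A \<subseteq> {..<v}" using assms by (simp add: ksubsets_def)
  then have "card (orbit v 1 A) \<le> v" using card_orbit_le[of 1 v A] assms by simp
  then have "k * card (orbit v 1 A) \<le> k * v" by (rule mult_le_mono2)
  then have "v * card {B \<in> orbit v 1 A. 0 \<in> B} \<le> v * k"
    by (simp only: orbit_size[OF assms] mult.commute[of v k])
  then show ?thesis by (simp only: nat_mult_le_cancel1[OF assms(2)])
qed

text \<open>Counting incidences gives \<open>v * d = k * card (orbit v 1 A)\<close> for the common degree \<open>d\<close>, so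
  \<open>v\<close> divides the size of the orbit, which is at most \<open>v\<close>. Hence no nonzero translation stabilises a
  \<open>k\<close>-subset.\<close>

lemma orbit_degree_coprime:
  assumes "A \<in> ksubsets v k" "v > 0" "coprime v k"
  shows "card {B \<in> orbit v 1 A. 0 \<in> B} = k"
proof -
  have A: "A \<subseteq> {..<v}" using assms by (simp add: ksubsets_def)
  have "v dvd k * card (orbit v 1 A)" using orbit_size[OF assms(1,2)] by (metis dvd_triv_left)
  then have "v dvd card (orbit v 1 A)" using assms(3) by (simp add: coprime_dvd_mult_right_iff)
  moreover have "finite (orbit v 1 A)"
    using orbit_ksubsets[OF assms(1,2)] finite_ksubsets finite_subset by blast
  then have "card (orbit v 1 A) > 0" using orbit_self[OF A, of 1] by (auto simp: card_gt_0_iff)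
  ultimately have "card (orbit v 1 A) = v"
    using card_orbit_le[of 1 v A] A assms(2) by (auto dest: dvd_imp_le)
  then show ?thesis using orbit_size[OF assms(1,2)] assms(2) by simp
qed

text \<open>All cyclic orbits have the same degree \<open>k\<close>, so they can be distributed arbitrarily, \<open>c\<close> to each colour.\<close>

lemma regular_colouring_coprime:
  assumes "coprime v k" "v > 0" "k > 0" "N > 0"
    and "k * (N * c) = supersets_count v k 1"
  shows "\<exists>col. regular_colouring col v k N (k * c)"
proof (rule regular_colouring_from_pieces[where g = "orbit v 1" and w = "\<lambda>_. 1" and W = 0])
  fix A assume A: "A \<in> ksubsets v k"
  then have sub: "A \<subseteq> {..<v}" by (simp add: ksubsets_def)
  show "A \<in> orbit v 1 A" using orbit_self[OF sub] .
  show "orbit v 1 A \<subseteq> ksubsets v k" using orbit_ksubsets[OF A assms(2)] .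
  show "orbit v 1 B = orbit v 1 A" if "B \<in> orbit v 1 A" for B
    using orbit_eq[OF sub assms(2) that] .
  show "card {B \<in> orbit v 1 A. x \<in> B} = k * 1" if "x < v" for x
    using orbit_degree_const[OF A that] orbit_degree_coprime[OF A assms(2,1)] by simp
qed (use assms in auto)

section \<open>Regular colourings of the 4-subsets\<close>

text \<open>For \<open>k = 4\<close> and \<open>4 dvd v\<close> short orbits exist and the weights differ. To obtain many pieces of
  degree 1, the sets that meet every residue class modulo 4 are grouped into the smaller orbits under
  translation by multiples of 4: each of these is a partition of the points.\<close>

definition transversal4 :: "nat set \<Rightarrow> bool" where
  "transversal4 A \<longleftrightarrow> (\<lambda>x. x mod 4) ` A = {..<4}"

lemma translate_transversal4:
  assumes "4 dvd v" "transversal4 A"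
  shows "transversal4 (translate v s A)"
proof -
  have "(\<lambda>x. x mod 4) ` translate v s A = (\<lambda>x. (x + s) mod 4) ` A"
    by (simp add: translate_def image_image mod_mod_cancel[OF assms(1)])
  also have "\<dots> = (\<lambda>x. (x + s) mod 4) ` (\<lambda>x. x mod 4) ` A"
    by (simp add: image_image mod_add_left_eq)
  also have "\<dots> = (\<lambda>x. (x + s) mod 4) ` {..<4}" using assms(2) by (simp add: transversal4_def)
  also have "\<dots> = {..<4}"
    by (intro endo_inj_surj inj_on_add_mod) auto
  finally show ?thesis by (simp add: transversal4_def)
qed

lemma transversal4_orbit:
  assumes "4 dvd v" "v > 0" "A \<subseteq> {..<v}" "B \<in> orbit v r A"
  shows "transversal4 B \<longleftrightarrow> transversal4 A"
proof -
  have *: "transversal4 C'" if "transversal4 C" "C' \<in> orbit v r C" for C C'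
    using that translate_transversal4[OF assms(1)] by (auto simp: orbit_def)
  have "A \<in> orbit v r B" using orbit_eq[OF assms(3,2,4)] orbit_self[OF assms(3)] by simp
  then show ?thesis using * assms(4) by blast
qed

text \<open>Every point \<open>y\<close> is covered: shift the element of \<open>A\<close> in the residue class of \<open>y\<close> onto \<open>y\<close>.
  Since the orbit consists of at most \<open>v div 4\<close> sets of size 4, no point is covered twice.\<close>

lemma orbit4_degree:
  assumes "4 dvd v" "A \<in> ksubsets v 4" "transversal4 A" "x < v"
  shows "card {B \<in> orbit v 4 A. x \<in> B} = 1"
proof -
  have v: "v > 0" using assms by simp
  have A: "A \<subseteq> {..<v}" using assms by (simp add: ksubsets_def)
  have fin: "finite (orbit v 4 A)"
    using orbit_ksubsets[OF assms(2) v] finite_ksubsets finite_subset by blast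
  have ge: "1 \<le> card {B \<in> orbit v 4 A. y \<in> B}" if y: "y < v" for y
  proof -
    have "y mod 4 \<in> (\<lambda>x. x mod 4) ` A" using assms(3) by (simp add: transversal4_def)
    then obtain a where a: "a \<in> A" "y mod 4 = a mod 4" by auto
    have av: "a < v" using a(1) A by auto
    have "4 dvd (y + v) - a"
    proof -
      have "(y + v) mod 4 = a mod 4" using a(2) assms(1) by (metis mod_add_cong add_0_right dvd_imp_mod_0 mod_0)
      then show ?thesis using av by (subst mod_eq_dvd_iff_nat[symmetric]) auto
    qed
    then obtain s where s: "(y + v) - a = 4 * s" by (rule dvdE)
    then have "a + 4 * s = y + v" using av by linarith
    then have "(a + 4 * s) mod v = y" using y by simp
    then have "y \<in> translate v (4 * s) A" using a(1) by (auto simp: translate_def)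
    then have "translate v (4 * s) A \<in> {B \<in> orbit v 4 A. y \<in> B}" by (auto simp: orbit_def)
    moreover have "finite {B \<in> orbit v 4 A. y \<in> B}" using fin by simp
    ultimately show ?thesis by (metis One_nat_def Suc_leI card_gt_0_iff empty_iff)
  qed
  have "(\<Sum>y<v. card {B \<in> orbit v 4 A. y \<in> B}) = 4 * card (orbit v 4 A)"
    by (rule sum_degrees_uniform[OF orbit_ksubsets[OF assms(2) v]])
  also have "\<dots> \<le> 4 * (v div 4)" using card_orbit_le[OF assms(1) v A] by simp
  also have "\<dots> = v" using assms(1) by simp
  finally have ub: "(\<Sum>y<v. card {B \<in> orbit v 4 A. y \<in> B}) \<le> v" .
  show ?thesis
  proof (rule ccontr)
    assume "\<not> ?thesis"
    then have "1 < card {B \<in> orbit v 4 A. x \<in> B}" using ge[OF assms(4)] by simp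
    then have "(\<Sum>y<v. 1) < (\<Sum>y<v. card {B \<in> orbit v 4 A. y \<in> B})"
      using ge assms(4) by (intro sum_strict_mono_ex1) auto
    then show False using ub by simp
  qed
qed

definition piece4 :: "nat \<Rightarrow> nat set \<Rightarrow> nat set set" where
  "piece4 v A = (if transversal4 A then orbit v 4 A else orbit v 1 A)"

lemma transversal4_box: "transversal4 {4 * a, 4 * b + 1, 4 * c + 2, 4 * d + 3}"
proof -
  have "{..<4::nat} = {0, 1, 2, 3}" by auto
  moreover have "(4 * a) mod 4 = 0" "(4 * b + 1) mod 4 = 1" "(4 * c + 2) mod 4 = 2" "(4 * d + 3) mod 4 = 3"
    by presburger+
  ultimately show ?thesis by (simp only: transversal4_def image_insert image_empty)
qed

text \<open>The sets \<open>{0, 4a + 1, 4b + 2, 4c + 3}\<close> lie in pairwise distinct pieces, because a piece that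
  is a partition has only one member through 0.\<close>

lemma many_light_pieces:
  assumes "v = 4 * n" "n > 0"
  shows "n ^ 3 \<le> card {P \<in> piece4 v ` ksubsets v 4. card {B \<in> P. 0 \<in> B} = 1}"
proof -
  let ?box = "\<lambda>(a, b, c). {0, 4 * a + 1, 4 * b + 2, 4 * c + 3} :: nat set"
  let ?D = "{..<n} \<times> {..<n} \<times> {..<n}"
  have box4: "transversal4 (?box t)" for t
    using transversal4_box[of 0] by (cases t) simp
  have boxk: "?box t \<in> ksubsets v 4" if "t \<in> ?D" for t
  proof -
    obtain a b c where t: "t = (a, b, c)" by (cases t)
    have "(4 * a + 1) \<noteq> (4 * b + 2)" "(4 * a + 1) \<noteq> (4 * c + 3)" "(4 * b + 2) \<noteq> (4 * c + 3)"
      by presburger+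
    then show ?thesis using that assms t by (auto simp: ksubsets_def)
  qed
  have "inj_on (\<lambda>t. piece4 v (?box t)) ?D"
  proof (rule inj_onI)
    fix t t' assume t: "t \<in> ?D" "t' \<in> ?D" "piece4 v (?box t) = piece4 v (?box t')"
    obtain a b c where abc: "t = (a, b, c)" by (cases t)
    obtain a' b' c' where abc': "t' = (a', b', c')" by (cases t')
    have "orbit v 4 (?box t) = orbit v 4 (?box t')"
      using t(3) box4[of t] box4[of t'] by (simp only: piece4_def if_True)
    then have mem: "?box t \<in> orbit v 4 (?box t')" "?box t' \<in> orbit v 4 (?box t')"
      using orbit_self[of "?box t" v 4] orbit_self[of "?box t'" v 4] boxk[OF t(1)] boxk[OF t(2)]
      by (simp_all only: ksubsets_def mem_Collect_eq)
    have "card {B \<in> orbit v 4 (?box t'). 0 \<in> B} = 1"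
      using boxk[OF t(2)] box4 assms by (intro orbit4_degree) auto
    then obtain S where S: "{B \<in> orbit v 4 (?box t'). 0 \<in> B} = {S}"
      by (rule card_1_singletonE)
    have "?box t \<in> {B \<in> orbit v 4 (?box t'). 0 \<in> B}" "?box t' \<in> {B \<in> orbit v 4 (?box t'). 0 \<in> B}"
      using mem by (simp_all add: abc abc')
    then have "?box t = ?box t'" unfolding S by simp
    then have eq: "{0, 4 * a + 1, 4 * b + 2, 4 * c + 3} = {0, 4 * a' + 1, 4 * b' + 2, 4 * c' + 3}"
      by (simp add: abc abc')
    have "4 * a + 1 \<in> {0, 4 * a' + 1, 4 * b' + 2, 4 * c' + 3}"
      "4 * b + 2 \<in> {0, 4 * a' + 1, 4 * b' + 2, 4 * c' + 3}"
      "4 * c + 3 \<in> {0, 4 * a' + 1, 4 * b' + 2, 4 * c' + 3}"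
      unfolding eq[symmetric] by blast+
    then have abc_cases: "4 * a + 1 = 0 \<or> 4 * a + 1 = 4 * a' + 1 \<or> 4 * a + 1 = 4 * b' + 2 \<or> 4 * a + 1 = 4 * c' + 3"
      "4 * b + 2 = 0 \<or> 4 * b + 2 = 4 * a' + 1 \<or> 4 * b + 2 = 4 * b' + 2 \<or> 4 * b + 2 = 4 * c' + 3"
      "4 * c + 3 = 0 \<or> 4 * c + 3 = 4 * a' + 1 \<or> 4 * c + 3 = 4 * b' + 2 \<or> 4 * c + 3 = 4 * c' + 3"
      by (simp_all only: insert_iff empty_iff simp_thms)
    have "a = a'" using abc_cases(1) by presburger
    moreover have "b = b'" using abc_cases(2) by presburger
    moreover have "c = c'" using abc_cases(3) by presburger
    ultimately show "t = t'" by (simp add: abc abc')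
  qed
  then have "card ((\<lambda>t. piece4 v (?box t)) ` ?D) = n ^ 3"
    by (simp add: card_image power3_eq_cube)
  moreover have "(\<lambda>t. piece4 v (?box t)) ` ?D \<subseteq> {P \<in> piece4 v ` ksubsets v 4. card {B \<in> P. 0 \<in> B} = 1}"
  proof (rule image_subsetI)
    fix t assume t: "t \<in> ?D"
    have "card {B \<in> orbit v 4 (?box t). 0 \<in> B} = 1"
      using boxk[OF t] box4 assms by (intro orbit4_degree) auto
    then show "piece4 v (?box t) \<in> {P \<in> piece4 v ` ksubsets v 4. card {B \<in> P. 0 \<in> B} = 1}"
      using boxk[OF t] box4[of t] by (simp add: piece4_def)
  qed
  ultimately show ?thesis
    using card_mono[of "{P \<in> piece4 v ` ksubsets v 4. card {B \<in> P. 0 \<in> B} = 1}"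
        "(\<lambda>t. piece4 v (?box t)) ` ?D"] by simp
qed

text \<open>Cyclic orbits of 4-subsets have degree at most 4, so three light pieces per colour are enough
  for the greedy distribution.\<close>

lemma regular_colouring_4:
  assumes "v = 4 * n" "n > 0" "N > 0" "3 * N \<le> n ^ 3" "N * c = supersets_count v 4 1"
  shows "\<exists>col. regular_colouring col v 4 N c"
proof -
  have v: "v > 0" "4 dvd v" using assms by auto
  have "\<exists>col. regular_colouring col v 4 N (1 * c)"
  proof (rule regular_colouring_from_pieces[where g = "piece4 v" and W = 4
        and w = "\<lambda>P. card {B \<in> P. 0 \<in> B}"])
    fix A assume A: "A \<in> ksubsets v 4"
    then have sub: "A \<subseteq> {..<v}" by (simp add: ksubsets_def)
    show "A \<in> piece4 v A" using orbit_self[OF sub] by (simp add: piece4_def)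
    show "piece4 v A \<subseteq> ksubsets v 4"
      using orbit_ksubsets[OF A v(1)] by (simp add: piece4_def)
    show "piece4 v B = piece4 v A" if "B \<in> piece4 v A" for B
    proof (cases "transversal4 A")
      case True
      then have B: "B \<in> orbit v 4 A" using that by (simp add: piece4_def)
      show ?thesis
        using True orbit_eq[OF sub v(1) B] transversal4_orbit[OF v(2,1) sub B]
        by (simp add: piece4_def)
    next
      case False
      then have B: "B \<in> orbit v 1 A" using that by (simp add: piece4_def)
      show ?thesis
        using False orbit_eq[OF sub v(1) B] transversal4_orbit[OF v(2,1) sub B]
        by (simp add: piece4_def)
    qed
    show "card {B \<in> piece4 v A. x \<in> B} = 1 * card {B \<in> piece4 v A. 0 \<in> B}" if "x < v" for x
    proof (cases "transversal4 A")
      case True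
      then show ?thesis
        using orbit4_degree[OF v(2) A True that] orbit4_degree[OF v(2) A True v(1)]
        by (simp add: piece4_def)
    next
      case False
      then show ?thesis using orbit_degree_const[OF A that] by (simp add: piece4_def)
    qed
    have "card {B \<in> piece4 v A. 0 \<in> B} \<le> 4"
    proof (cases "transversal4 A")
      case True
      then show ?thesis using orbit4_degree[OF v(2) A True v(1)] by (simp add: piece4_def)
    next
      case False
      then show ?thesis using orbit_degree_le[OF A v(1)] by (simp add: piece4_def)
    qed
    moreover have "(4 - 1) * N \<le> card {P \<in> piece4 v ` ksubsets v 4. card {B \<in> P. 0 \<in> B} = 1}"
      using many_light_pieces[OF assms(1,2)] assms(4) by simp
    ultimately show "card {B \<in> piece4 v A. 0 \<in> B} \<le> 4 \<and>
      (4 - 1) * N \<le> card {P \<in> piece4 v ` ksubsets v 4. card {B \<in> P. 0 \<in> B} = 1}" by blast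
  qed (use assms v in auto)
  then show ?thesis by simp
qed

section \<open>One-factorisation of the complete graph\<close>

text \<open>The classical one-factorisation: the points below \<open>n\<close> are the residues modulo \<open>n\<close>, the point \<open>n\<close>
  is the additional point at infinity, and the edge from infinity to \<open>x\<close> receives the colour \<open>2 * x\<close>
  of the missing loop at \<open>x\<close>.\<close>

definition one_factor_colour :: "nat \<Rightarrow> nat set \<Rightarrow> nat" where
  "one_factor_colour n A = (if n \<in> A then 2 * \<Sum>(A - {n}) else \<Sum>A) mod n"

lemma inj_on_double_mod:
  fixes n :: nat
  assumes "odd n"
  shows "inj_on (\<lambda>y. (2 * y) mod n) {..<n}"
proof (rule linorder_inj_onI)
  fix a b assume ab: "a < b" "a \<in> {..<n}" "b \<in> {..<n}"
  show "(2 * a) mod n \<noteq> (2 * b) mod n"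
  proof
    assume "(2 * a) mod n = (2 * b) mod n"
    then have "n dvd 2 * b - 2 * a"
      using ab by (subst mod_eq_dvd_iff_nat[symmetric]) auto
    then have "n dvd 2 * (b - a)" by (simp add: diff_mult_distrib2)
    moreover have "coprime n 2" using assms by simp
    ultimately have "n dvd b - a" by (simp add: coprime_dvd_mult_right_iff)
    then have "n \<le> b - a" using ab by (intro dvd_imp_le) auto
    then show False using ab by auto
  qed
qed auto

text \<open>At every point, the \<open>n\<close> edges receive distinct colours, hence each of the \<open>n\<close> colours once. At
  infinity this uses that doubling is injective modulo an odd number.\<close>

lemma regular_colouring_2:
  assumes "odd n"
  shows "regular_colouring (one_factor_colour n) (Suc n) 2 n 1"
  unfolding regular_colouring_def
proof (intro conjI ballI allI impI)
  fix A show "one_factor_colour n A < n"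
    using odd_pos[OF assms] by (simp add: one_factor_colour_def)
next
  fix i x assume i: "i < n" and x: "x < Suc n"
  let ?f = "\<lambda>y. one_factor_colour n {x, y}"
  let ?Y = "{..<Suc n} - {x}"
  have n: "n > 0" using i by simp
  have inj: "inj_on ?f ?Y"
  proof (cases "x = n")
    case True
    have f: "?f y = (2 * y) mod n" if "y \<in> ?Y" for y
    proof -
      have "{x, y} - {n} = {y}" using that True by auto
      then show ?thesis using True by (simp add: one_factor_colour_def)
    qed
    have "?Y \<subseteq> {..<n}" using True by auto
    then have "inj_on (\<lambda>y. (2 * y) mod n) ?Y"
      by (rule inj_on_subset[OF inj_on_double_mod[OF assms]])
    moreover have "inj_on ?f ?Y \<longleftrightarrow> inj_on (\<lambda>y. (2 * y) mod n) ?Y"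
      using f by (rule inj_on_cong)
    ultimately show ?thesis by simp
  next
    case False
    let ?g = "\<lambda>y. if y = n then x else y"
    have f: "?f y = (?g y + x) mod n" if "y \<in> ?Y" for y
    proof (cases "y = n")
      case True
      have "{x, n} - {n} = {x}" using False by auto
      then show ?thesis using True by (simp add: one_factor_colour_def mult_2)
    next
      case yn: False
      then show ?thesis using that False by (simp add: one_factor_colour_def add.commute)
    qed
    show ?thesis
    proof (rule inj_onI)
      fix y y' assume y: "y \<in> ?Y" "y' \<in> ?Y" and eq: "?f y = ?f y'"
      have "(?g y + x) mod n = (?g y' + x) mod n" using f[OF y(1)] f[OF y(2)] eq by simp
      moreover have "?g y \<in> {..<n}" "?g y' \<in> {..<n}" using y x False by auto
      ultimately have "?g y = ?g y'" by (rule inj_onD[OF inj_on_add_mod[OF n]])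
      then show "y = y'" using y by (auto split: if_splits)
    qed
  qed
  have "?f ` ?Y \<subseteq> {..<n}" using n by (auto simp: one_factor_colour_def)
  moreover have "card (?f ` ?Y) = card {..<n}" using x by (simp add: card_image[OF inj])
  ultimately have "?f ` ?Y = {..<n}" by (intro card_subset_eq) simp_all
  then obtain y where y: "y \<in> ?Y" "i = ?f y" using i by blast
  have "{A \<in> ksubsets (Suc n) 2. one_factor_colour n A = i \<and> x \<in> A} = {{x, y}}"
  proof (intro equalityI subsetI)
    fix A assume A: "A \<in> {A \<in> ksubsets (Suc n) 2. one_factor_colour n A = i \<and> x \<in> A}"
    then have "card A = 2" "x \<in> A" by (auto simp: ksubsets_def)
    then obtain y' where y': "A = {x, y'}" "y' \<noteq> x" by (auto simp: card_2_iff)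
    then have "y' \<in> ?Y" "?f y' = ?f y" using A y(2) by (auto simp: ksubsets_def)
    then have "y' = y" using inj y(1) by (auto dest: inj_onD)
    then show "A \<in> {{x, y}}" using y' by simp
  next
    fix A assume "A \<in> {{x, y}}"
    then show "A \<in> {A \<in> ksubsets (Suc n) 2. one_factor_colour n A = i \<and> x \<in> A}"
      using x y by (auto simp: ksubsets_def)
  qed
  then show "card {A \<in> ksubsets (Suc n) 2. one_factor_colour n A = i \<and> x \<in> A} = 1" by simp
qed

section \<open>Blocks on two copies of the point set\<close>

definition join :: "nat \<Rightarrow> nat set \<times> nat set \<Rightarrow> nat set" where
  "join v = (\<lambda>(A, B). A \<union> (+) v ` B)"

lemma join_subset_iff:
  fixes v :: nat
  assumes "T \<subseteq> {..<2 * v}" "A \<subseteq> {..<v}" "B \<subseteq> {..<v}"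
  shows "T \<subseteq> join v (A, B) \<longleftrightarrow> T \<inter> {..<v} \<subseteq> A \<and> {y. y < v \<and> v + y \<in> T} \<subseteq> B"
proof
  assume T: "T \<subseteq> join v (A, B)"
  show "T \<inter> {..<v} \<subseteq> A \<and> {y. y < v \<and> v + y \<in> T} \<subseteq> B"
  proof (intro conjI subsetI)
    fix x assume "x \<in> T \<inter> {..<v}"
    then show "x \<in> A" using T by (auto simp: join_def)
  next
    fix y assume "y \<in> {y. y < v \<and> v + y \<in> T}"
    then have "v + y \<in> join v (A, B)" using T by auto
    then show "y \<in> B" using assms(2) by (auto simp: join_def)
  qed
next
  assume T: "T \<inter> {..<v} \<subseteq> A \<and> {y. y < v \<and> v + y \<in> T} \<subseteq> B"
  show "T \<subseteq> join v (A, B)"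
  proof
    fix x assume x: "x \<in> T"
    show "x \<in> join v (A, B)"
    proof (cases "x < v")
      case True
      then show ?thesis using T x by (auto simp: join_def)
    next
      case False
      then have "x = v + (x - v)" "x - v < v" using assms(1) x by auto
      then have "x - v \<in> B" using T x by auto
      then show ?thesis using \<open>x = v + (x - v)\<close> by (auto simp: join_def intro!: image_eqI)
    qed
  qed
qed

lemma card_join:
  assumes "A \<in> ksubsets v a" "B \<in> ksubsets v b"
  shows "card (join v (A, B)) = a + b"
proof -
  have "A \<inter> (+) v ` B = {}" using assms by (auto simp: ksubsets_def)
  moreover have "card ((+) v ` B) = b" using assms by (simp add: card_image ksubsets_def)
  ultimately show ?thesis
    using assms finite_ksubset[OF assms(1)] finite_ksubset[OF assms(2)]
    by (simp add: join_def card_Un_disjoint ksubsets_def)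
qed

lemma inj_on_join: "inj_on (join v) (Pow {..<v} \<times> Pow {..<v})"
proof (rule inj_onI)
  fix p q assume pq: "p \<in> Pow {..<v} \<times> Pow {..<v}" "q \<in> Pow {..<v} \<times> Pow {..<v}"
    "join v p = join v q"
  obtain A B C D where p: "p = (A, B)" and q: "q = (C, D)" by (cases p, cases q)
  have sub: "A \<subseteq> {..<v}" "B \<subseteq> {..<v}" "C \<subseteq> {..<v}" "D \<subseteq> {..<v}" using pq p q by auto
  have left: "join v (A', B') \<inter> {..<v} = A'" if "A' \<subseteq> {..<v}" for A' B'
    using that by (auto simp: join_def)
  have right: "{y. v + y \<in> join v (A', B')} = B'" if "A' \<subseteq> {..<v}" for A' B'
    using that by (auto simp: join_def)
  have "A = C" using left[OF sub(1), of B] left[OF sub(3), of D] pq(3) p q by simp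
  moreover have "B = D" using right[OF sub(1), of B] right[OF sub(3), of D] pq(3) p q by simp
  ultimately show "p = q" by (simp add: p q)
qed

lemma card_split:
  fixes v :: nat
  assumes "T \<subseteq> {..<2 * v}"
  shows "card (T \<inter> {..<v}) + card {y. y < v \<and> v + y \<in> T} = card T"
proof -
  have fin: "finite T" using finite_subset[OF assms] by simp
  have "T = (T \<inter> {..<v}) \<union> (+) v ` {y. y < v \<and> v + y \<in> T}" (is "_ = _ \<union> ?R")
  proof (intro equalityI subsetI)
    fix x assume x: "x \<in> T"
    show "x \<in> (T \<inter> {..<v}) \<union> ?R"
    proof (cases "x < v")
      case False
      then have "x = v + (x - v)" "x - v < v" using assms x by auto
      then show ?thesis using x by (intro UnI2 image_eqI[of _ _ "x - v"]) auto
    qed (use x in auto)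
  qed auto
  moreover have "card ((T \<inter> {..<v}) \<union> ?R) = card (T \<inter> {..<v}) + card ?R"
    using fin by (intro card_Un_disjoint) auto
  ultimately show ?thesis by (simp add: card_image)
qed

lemma pairs_above_restrict:
  "{p \<in> pairs_above {} {} v N z ca a cb b. S \<subseteq> fst p \<and> T \<subseteq> snd p} = pairs_above S T v N z ca a cb b"
  by (auto simp: pairs_above_def band_pairs_def)

lemma pairs_above_ksubsets:
  "pairs_above S T v N z ca a cb b \<subseteq> ksubsets v a \<times> ksubsets v b"
  by (auto simp: pairs_above_def band_pairs_def)

lemma finite_pairs_above [simp]: "finite (pairs_above S T v N z ca a cb b)"
  by (rule finite_subset[OF pairs_above_ksubsets]) simp

lemma pairs_above_disjoint:
  assumes "a \<noteq> a'"
  shows "pairs_above S T v N z ca a cb b \<inter> pairs_above S T v N' z' ca' a' cb' b' = {}"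
proof -
  have "ksubsets v a \<inter> ksubsets v a' = {}" using assms by (auto simp: ksubsets_def)
  then have "(ksubsets v a \<times> ksubsets v b) \<inter> (ksubsets v a' \<times> ksubsets v b') = {}" by blast
  then show ?thesis
    using pairs_above_ksubsets[of S T v N z ca a cb b] pairs_above_ksubsets[of S T v N' z' ca' a' cb' b']
    by blast
qed

text \<open>A triple meets the two copies of the points in 3 + 0 or 2 + 1 points, up to exchanging the
  copies. The hypotheses \<open>pure\<close> and \<open>mixed\<close> say that both kinds lie in \<open>lam\<close> blocks; their
  four summands belong to the block types 5 + 2, 2 + 5, 4 + 3 and 3 + 4, in this order.\<close>

lemma three_design_from_colourings:
  assumes c2: "regular_colouring c2 v 2 n 1" and c3: "regular_colouring c3 v 3 N d3"
    and c4: "regular_colouring c4 v 4 N d4" and c5: "regular_colouring c5 v 5 n d5"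
    and z: "z \<le> n" "z' \<le> N"
    and e: "2 * e2 = v" "3 * e3 = v * d3" "4 * e4 = v * d4" "5 * e5 = v * d5"
    and pure: "supersets_count v 5 3 * (z * e2) + supersets_count v 2 3 * (z * e5)
        + supersets_count v 4 3 * (z' * e3) + supersets_count v 3 3 * (z' * e4) = lam"
    and mixed: "supersets_count v 5 2 * (z * 1) + supersets_count v 2 2 * (z * d5)
        + supersets_count v 4 2 * (z' * d3) + supersets_count v 3 2 * (z' * d4) = lam"
  shows "\<exists>B :: nat set multiset. t_design 3 (2 * v) 7 lam {..<2 * v} B \<and> simple_blocks B"
proof -
  let ?P = "\<lambda>S T. pairs_above S T v n z c5 5 c2 2 \<union> pairs_above S T v n z c2 2 c5 5 \<union>
      pairs_above S T v N z' c4 4 c3 3 \<union> pairs_above S T v N z' c3 3 c4 4"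
  have cardP: "card (?P S T) = card (pairs_above S T v n z c5 5 c2 2)
      + card (pairs_above S T v n z c2 2 c5 5) + card (pairs_above S T v N z' c4 4 c3 3)
      + card (pairs_above S T v N z' c3 3 c4 4)" for S T
  proof -
    have disj: "pairs_above S T v n z c5 5 c2 2 \<inter> pairs_above S T v n z c2 2 c5 5 = {}"
      "(pairs_above S T v n z c5 5 c2 2 \<union> pairs_above S T v n z c2 2 c5 5)
        \<inter> pairs_above S T v N z' c4 4 c3 3 = {}"
      "(pairs_above S T v n z c5 5 c2 2 \<union> pairs_above S T v n z c2 2 c5 5
        \<union> pairs_above S T v N z' c4 4 c3 3) \<inter> pairs_above S T v N z' c3 3 c4 4 = {}"
      by (simp_all add: Int_Un_distrib2 pairs_above_disjoint)
    show ?thesis by (simp add: card_Un_disjoint disj)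
  qed
  have pureP: "card (?P S {}) = lam" if "S \<subseteq> {..<v}" "card S = 3" for S
    unfolding cardP pure[symmetric]
    by (simp only: card_pairs_above_empty[OF c2 z(1) _ _ that, of e2]
        card_pairs_above_empty[OF c3 z(2) _ _ that, of e3]
        card_pairs_above_empty[OF c4 z(2) _ _ that, of e4]
        card_pairs_above_empty[OF c5 z(1) _ _ that, of e5] e mult_1_right zero_less_numeral)
  have mixedP: "card (?P S {y}) = lam" if "S \<subseteq> {..<v}" "card S = 2" "y < v" for S y
    unfolding cardP mixed[symmetric]
    by (simp only: card_pairs_above_point[OF c2 z(1) that] card_pairs_above_point[OF c3 z(2) that]
        card_pairs_above_point[OF c4 z(2) that] card_pairs_above_point[OF c5 z(1) that])
  have swapP: "card (?P S T) = card (?P T S)" for S T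
    unfolding cardP
    by (subst (1 2 3 4) card_pairs_above_swap) simp
  have main: "card (?P S T) = lam" if ST: "S \<subseteq> {..<v}" "T \<subseteq> {..<v}" "card S + card T = 3" for S T
  proof -
    have fin: "finite S" "finite T" using finite_subset[OF ST(1)] finite_subset[OF ST(2)] by simp_all
    consider "card S = 3" "T = {}" | "card S = 2" "card T = 1" | "card T = 2" "card S = 1"
      | "card T = 3" "S = {}"
    proof -
      have "card S = 3 \<and> card T = 0 \<or> card S = 2 \<and> card T = 1 \<or> card T = 2 \<and> card S = 1
          \<or> card T = 3 \<and> card S = 0"
        using ST(3) by presburger
      then show ?thesis using that fin by (auto simp only: card_0_eq)
    qed
    then show ?thesis
    proof cases
      case 1
      then show ?thesis using pureP ST(1) by blast
    next
      case 2
      then obtain y where "T = {y}" using card_1_singletonE by blast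
      then show ?thesis using mixedP[of S y] ST 2 by auto
    next
      case 3
      then obtain y where "S = {y}" using card_1_singletonE by blast
      then show ?thesis using mixedP[of T y] swapP[of S T] ST 3 by auto
    next
      case 4
      then show ?thesis using pureP[OF ST(2)] swapP[of S T] by simp
    qed
  qed
  let ?Q = "?P {} {}"
  let ?B = "join v ` ?Q"
  have Qsub: "?Q \<subseteq> Pow {..<v} \<times> Pow {..<v}"
    using pairs_above_ksubsets[of "{}" "{}" v] unfolding ksubsets_def by blast
  have finB: "finite ?B" by simp
  have inj: "inj_on (join v) ?Q" by (rule inj_on_subset[OF inj_on_join Qsub])
  have card7: "card (join v p) = 7" if "p \<in> ?Q" for p
  proof -
    have "p \<in> ksubsets v 5 \<times> ksubsets v 2 \<or> p \<in> ksubsets v 2 \<times> ksubsets v 5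
        \<or> p \<in> ksubsets v 4 \<times> ksubsets v 3 \<or> p \<in> ksubsets v 3 \<times> ksubsets v 4"
      using that pairs_above_ksubsets[of "{}" "{}" v] by blast
    then show ?thesis by (elim disjE) (auto simp: card_join)
  qed
  have joinsub: "join v p \<subseteq> {..<2 * v}" if "p \<in> ?Q" for p
  proof -
    obtain A B where p: "p = (A, B)" by (cases p)
    then have "A \<subseteq> {..<v}" "B \<subseteq> {..<v}" using that Qsub by blast+
    then show ?thesis by (auto simp: p join_def)
  qed
  have count: "card {b \<in> ?B. T \<subseteq> b} = lam" if T: "T \<subseteq> {..<2 * v}" "card T = 3" for T
  proof -
    let ?S0 = "T \<inter> {..<v}" and ?S1 = "{y. y < v \<and> v + y \<in> T}"
    have iff: "T \<subseteq> join v p \<longleftrightarrow> ?S0 \<subseteq> fst p \<and> ?S1 \<subseteq> snd p" if "p \<in> ?Q" for p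
    proof -
      obtain A B where p: "p = (A, B)" by (cases p)
      then have "A \<subseteq> {..<v}" "B \<subseteq> {..<v}" using that Qsub by blast+
      then show ?thesis using join_subset_iff[OF T(1)] p by simp
    qed
    have "{b \<in> ?B. T \<subseteq> b} = join v ` {p \<in> ?Q. T \<subseteq> join v p}" by blast
    also have "{p \<in> ?Q. T \<subseteq> join v p} = {p \<in> ?Q. ?S0 \<subseteq> fst p \<and> ?S1 \<subseteq> snd p}"
      using iff by (intro Collect_cong) (simp only: cong: conj_cong)
    also have "\<dots> = ?P ?S0 ?S1"
      by (simp only: Un_iff Collect_disj_eq conj_disj_distribR pairs_above_restrict)
    finally have eq: "{b \<in> ?B. T \<subseteq> b} = join v ` ?P ?S0 ?S1" .
    have "?P ?S0 ?S1 \<subseteq> ?Q" by (auto simp: pairs_above_def band_pairs_def)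
    then have "card {b \<in> ?B. T \<subseteq> b} = card (?P ?S0 ?S1)"
      unfolding eq by (intro card_image inj_on_subset[OF inj])
    also have "\<dots> = lam" using card_split[OF T(1)] T(2) by (intro main) auto
    finally show ?thesis .
  qed
  have "t_design 3 (2 * v) 7 lam {..<2 * v} (mset_set ?B)"
    unfolding t_design_def
  proof (intro conjI ballI allI impI)
    fix b assume "b \<in># mset_set ?B"
    then obtain p where p: "p \<in> ?Q" "b = join v p" using finB by auto
    then show "b \<subseteq> {..<2 * v}" "card b = 7" using joinsub card7 by auto
  next
    fix T :: "nat set" assume "T \<subseteq> {..<2 * v} \<and> card T = 3"
    then have "card {b \<in> ?B. T \<subseteq> b} = lam" using count by blast
    then show "size {#b \<in># mset_set ?B. T \<subseteq> b#} = lam"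
      using finB by (simp only: filter_mset_mset_set size_mset_set)
  qed simp_all
  moreover have "simple_blocks (mset_set ?B)"
    unfolding simple_blocks_def using finB by simp
  ultimately show ?thesis by blast
qed

section \<open>The parameters\<close>

lemma real_choose_2: "real (n choose 2) = real n * (real n - 1) / 2"
  by (induction n) (simp_all add: numeral_2_eq_2 field_simps)

lemma real_choose_3: "real (n choose 3) = real n * (real n - 1) * (real n - 2) / 6"
proof (induction n)
  case (Suc n)
  have "Suc n choose 3 = (n choose 2) + (n choose 3)" by (simp add: numeral_3_eq_3 numeral_2_eq_2)
  then have "real (Suc n choose 3) = real (n choose 2) + real (n choose 3)" by simp
  then show ?case by (simp only: Suc.IH real_choose_2) (simp add: field_simps)
qed simp

lemma real_choose_4:
  "real (n choose 4) = real n * (real n - 1) * (real n - 2) * (real n - 3) / 24"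
proof (induction n)
  case (Suc n)
  have "Suc n choose 4 = (n choose 3) + (n choose 4)" by (simp add: eval_nat_numeral)
  then have "real (Suc n choose 4) = real (n choose 3) + real (n choose 4)" by simp
  then show ?case by (simp only: Suc.IH real_choose_3) (simp add: field_simps)
qed simp

theorem theorem3p3:
  fixes v m :: nat
  assumes "v \<ge> 32"
    and "v mod 60 \<in> {4, 8, 28, 32, 44, 52}"
    and "m \<ge> 1"
    and "real m \<le> (real v - 1) / 30"
  shows "\<exists>(lam :: nat) (X :: nat set) (B :: nat set multiset).
    real lam = 35 / 4 * real v * (real v - 2) * (real v - 3) * real m \<and>
    t_design 3 (2 * v) 7 lam X B \<and> simple_blocks B"
proof -
  define q where "q = v div 60"
  have v60: "v = 60 * q + v mod 60" by (simp add: q_def)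
  have res: "v mod 60 = 4 \<or> v mod 60 = 8 \<or> v mod 60 = 28 \<or> v mod 60 = 32 \<or> v mod 60 = 44 \<or> v mod 60 = 52"
    using assms(2) by simp
  have "6 dvd (v - 1) * (v - 2)"
  proof -
    define p where "p = v div 12"
    have "v mod 12 = v mod 60 mod 12" by (simp add: mod_mod_cancel)
    then have "v mod 12 = 4 \<or> v mod 12 = 8" using res by auto
    moreover have "v = 12 * p + v mod 12" by (simp add: p_def)
    ultimately have "v = 12 * p + 4 \<or> v = 12 * p + 8" by metis
    then have "(v - 1) * (v - 2) = 6 * ((4 * p + 1) * (6 * p + 1))
        \<or> (v - 1) * (v - 2) = 6 * ((12 * p + 7) * (2 * p + 1))"
      by (elim disjE) (simp_all add: algebra_simps)
    then show ?thesis by auto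
  qed
  then obtain N where N: "(v - 1) * (v - 2) = 6 * N" by (rule dvdE)
  have "120 dvd (v - 2) * (v - 3) * (v - 4)"
  proof -
    have "(v - 2) * (v - 3) * (v - 4) = 120 * ((30 * q + 1) * (60 * q + 1) * q)" if "v mod 60 = 4"
      using v60 unfolding that by (simp add: algebra_simps)
    moreover have "(v - 2) * (v - 3) * (v - 4) = 120 * ((10 * q + 1) * (12 * q + 1) * (15 * q + 1))"
      if "v mod 60 = 8"
      using v60 unfolding that by (simp add: algebra_simps)
    moreover have "(v - 2) * (v - 3) * (v - 4) = 120 * ((30 * q + 13) * (12 * q + 5) * (5 * q + 2))"
      if "v mod 60 = 28"
      using v60 unfolding that by (simp add: algebra_simps)
    moreover have "(v - 2) * (v - 3) * (v - 4) = 120 * ((2 * q + 1) * (60 * q + 29) * (15 * q + 7))"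
      if "v mod 60 = 32"
      using v60 unfolding that by (simp add: algebra_simps)
    moreover have "(v - 2) * (v - 3) * (v - 4) = 120 * ((10 * q + 7) * (60 * q + 41) * (3 * q + 2))"
      if "v mod 60 = 44"
      using v60 unfolding that by (simp add: algebra_simps)
    moreover have "(v - 2) * (v - 3) * (v - 4) = 120 * ((6 * q + 5) * (60 * q + 49) * (5 * q + 4))"
      if "v mod 60 = 52"
      using v60 unfolding that by (simp add: algebra_simps)
    ultimately show ?thesis using res by (elim disjE) (simp_all only: dvd_triv_left)
  qed
  then obtain c where c: "(v - 2) * (v - 3) * (v - 4) = 120 * c" by (rule dvdE)
  have "v mod 4 = v mod 60 mod 4" by (simp add: mod_mod_cancel)
  then have "4 dvd v" using res by auto
  then obtain n where n: "v = 4 * n" by (rule dvdE)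
  have n8: "n \<ge> 8" using n assms(1) by simp
  have "v mod 3 = v mod 60 mod 3" by (simp add: mod_mod_cancel)
  then have "v mod 3 = 1 \<or> v mod 3 = 2" using res by auto
  moreover have "coprime (1::nat) 3" "coprime (2::nat) 3"
    by (simp_all add: coprime_iff_gcd_eq_1 gcd_non_0_nat)
  ultimately have "coprime (v mod 3) 3" by (elim disjE) simp_all
  then have cop3: "coprime v 3" by simp
  have "v mod 5 = v mod 60 mod 5" by (simp add: mod_mod_cancel)
  then have "v mod 5 = 2 \<or> v mod 5 = 3 \<or> v mod 5 = 4" using res by auto
  moreover have "coprime (2::nat) 5" "coprime (3::nat) 5" "coprime (4::nat) 5"
    by (simp_all add: coprime_iff_gcd_eq_1 gcd_non_0_nat)
  ultimately have "coprime (v mod 5) 5" by (elim disjE) simp_all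
  then have cop5: "coprime v 5" by simp
  have rN: "6 * real N = (real v - 1) * (real v - 2)"
    using arg_cong[OF N, of real] assms(1) by (simp add: of_nat_diff)
  have rc: "120 * real c = (real v - 2) * (real v - 3) * (real v - 4)"
    using arg_cong[OF c, of real] assms(1) by (simp add: of_nat_diff)
  have rv: "real v = 4 * real n" using n by simp
  have vpos: "v > 0" and vpos1: "v - 1 > 0" using assms(1) by simp_all
  have Npos: "N > 0" using N assms(1) by (cases N) auto

  have "real (3 * (N * 1)) = real (supersets_count v 3 1)"
    using assms(1) rN by (simp add: supersets_count_def real_choose_2 of_nat_diff algebra_simps)
  then have tot3: "3 * (N * 1) = supersets_count v 3 1" by (simp only: of_nat_eq_iff)
  obtain c3 where c3: "regular_colouring c3 v 3 N (3 * 1)"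
    using regular_colouring_coprime[OF cop3 vpos zero_less_numeral Npos tot3] by (rule exE)

  have "real (5 * ((v - 1) * c)) = (real v - 1) * (120 * real c) / 24"
    using assms(1) by (simp add: of_nat_diff)
  also have "\<dots> = real (supersets_count v 5 1)"
    using assms(1) by (simp add: rc supersets_count_def real_choose_4 of_nat_diff)
  finally have tot5: "5 * ((v - 1) * c) = supersets_count v 5 1" by (simp only: of_nat_eq_iff)
  obtain c5 where c5: "regular_colouring c5 v 5 (v - 1) (5 * c)"
    using regular_colouring_coprime[OF cop5 vpos zero_less_numeral vpos1 tot5] by (rule exE)

  have "odd (v - 1)" using n n8 by simp
  then have "regular_colouring (one_factor_colour (v - 1)) (Suc (v - 1)) 2 (v - 1) 1"
    by (rule regular_colouring_2)
  moreover have "Suc (v - 1) = v" using assms(1) by simp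
  ultimately have c2: "regular_colouring (one_factor_colour (v - 1)) v 2 (v - 1) 1" by simp

  have "real (N * (v - 3)) = (6 * real N) * (real v - 3) / 6"
    using assms(1) by (simp add: of_nat_diff)
  also have "\<dots> = real (supersets_count v 4 1)"
    using assms(1) by (simp add: rN supersets_count_def real_choose_3 of_nat_diff)
  finally have tot4: "N * (v - 3) = supersets_count v 4 1" by (simp only: of_nat_eq_iff)
  (* Enough light pieces: (v - 1) (v - 2) / 2 \<le> (v / 4) ^ 3, which needs v \<ge> 32. *)
  have "3 * N \<le> n ^ 3"
  proof -
    have "6 * N \<le> (4 * n) * (4 * n)" unfolding N[symmetric] n by (intro mult_le_mono) auto
    also have "\<dots> = 2 * (8 * n ^ 2)" by (simp add: power2_eq_square)
    also have "\<dots> \<le> 2 * (n * n ^ 2)" using n8 by (intro mult_le_mono) auto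
    also have "n * n ^ 2 = n ^ 3" by (simp add: power3_eq_cube power2_eq_square)
    finally show ?thesis by simp
  qed
  moreover have "n > 0" using n8 by simp
  ultimately obtain c4 where c4: "regular_colouring c4 v 4 N (v - 3)"
    using regular_colouring_4[OF n _ Npos _ tot4] by blast

  (* The widths solve the two linear equations that equate the number of blocks through a pure triple
     and through a mixed triple with the prescribed index. *)
  let ?z = "30 * m" and ?z' = "m * (v + 10)"
  have z: "?z \<le> v - 1"
  proof -
    have "real ?z \<le> real (v - 1)" using assms(1,4) by (simp add: of_nat_diff field_simps)
    then show ?thesis by (simp only: of_nat_le_iff)
  qed
  have z': "?z' \<le> N"
  proof -
    have "real m * (real v + 10) \<le> (real v - 1) / 30 * (real v + 10)"
      using assms(4) by (intro mult_right_mono) auto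
    also have "\<dots> \<le> (real v - 1) / 30 * (5 * (real v - 2))"
      using assms(1) by (intro mult_left_mono) auto
    also have "\<dots> = (real v - 1) * (real v - 2) / 6" by simp
    also have "\<dots> = real N" by (simp flip: rN)
    finally have "real ?z' \<le> real N" by simp
    then show ?thesis by (simp only: of_nat_le_iff)
  qed
  define lam where "lam = supersets_count v 5 3 * (?z * (2 * n)) + supersets_count v 2 3 * (?z * (v * c))
        + supersets_count v 4 3 * (?z' * v) + supersets_count v 3 3 * (?z' * (n * (v - 3)))"
  define lam' where "lam' = supersets_count v 5 2 * (?z * 1) + supersets_count v 2 2 * (?z * (5 * c))
        + supersets_count v 4 2 * (?z' * (3 * 1)) + supersets_count v 3 2 * (?z' * (v - 3))"
  have val: "real lam = 35 / 4 * real v * (real v - 2) * (real v - 3) * real m"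
  proof -
    have "real lam = (real v - 3) * (real v - 4) / 2 * (30 * real m * (2 * real n))
        + (real v - 3) * (real m * (real v + 10) * real v)
        + real m * (real v + 10) * (real n * (real v - 3))"
      using assms(1) by (simp add: lam_def supersets_count_def real_choose_2 of_nat_diff)
    also have "\<dots> = 35 / 4 * real v * (real v - 2) * (real v - 3) * real m"
      unfolding rv by (simp add: field_simps)
    finally show ?thesis .
  qed
  have val': "real lam' = 35 / 4 * real v * (real v - 2) * (real v - 3) * real m"
  proof -
    have "real lam' = (real v - 2) * (real v - 3) * (real v - 4) / 6 * (30 * real m)
        + 30 * real m * (120 * real c) / 24
        + (real v - 2) * (real v - 3) / 2 * (real m * (real v + 10) * 3)
        + (real v - 2) * (real m * (real v + 10) * (real v - 3))"
      using assms(1) by (simp add: lam'_def supersets_count_def real_choose_2 real_choose_3 of_nat_diff)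
    also have "\<dots> = 35 / 4 * real v * (real v - 2) * (real v - 3) * real m"
      unfolding rc by (simp add: field_simps)
    finally show ?thesis .
  qed
  have "real lam' = real lam" by (simp only: val val')
  then have lam_eq: "lam' = lam" by (simp only: of_nat_eq_iff)
  have "\<exists>B :: nat set multiset. t_design 3 (2 * v) 7 lam {..<2 * v} B \<and> simple_blocks B"
  proof (rule three_design_from_colourings[OF c2 c3 c4 c5 z z'])
    show "2 * (2 * n) = v" "4 * (n * (v - 3)) = v * (v - 3)" by (simp_all add: n)
    show "3 * v = v * (3 * 1)" "5 * (v * c) = v * (5 * c)" by simp_all
  qed (fact lam_def[symmetric], fact lam'_def[symmetric, unfolded lam_eq])
  then show ?thesis using val by blast
qed

end
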